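(* Let $G$ be a finite group and let $\Bbbk$ be an algebraically closed field of arbitrary characteristic (possibly dividing $|G|$). Then the torus partition function $\mathrm{Cor}_{1;0,0}:K\to\Bbbk$ associated with the Drinfeld double $\mathcal{D}G$ is modular invariant, i.e. $$\mathrm{Cor}_{1;0,0}\circ S_K=\mathrm{Cor}_{1;0,0}\qquad\text{and}\qquad \mathrm{Cor}_{1;0,0}\circ T_K=\mathrm{Cor}_{1;0,0}.$$
   Context: The Drinfeld double $\mathcal{D}G=\Bbbk(G)\otimes_{\Bbbk}\Bbbk[G]$ has basis $b_{g|x}:=\delta_g\otimes b_x$ ($g,x\in G$), where $\delta_g$ and $b_x$ are the usual bases of the function algebra $\Bbbk(G)$ and of the group algebra $\Bbbk[G]$. Let $\{\beta_{g|x}\}_{g,x\in G}$ be the dual basis of $\mathcal{D}G^*$. The symbol $\delta_{a,b}$ (for $a,b\in G$) is $1$ if $a=b$ and $0$ otherwise, $e\in G$ is the unit element, and $\otimes$ is over $\Bbbk$. As vector spaces, $F=\mathcal{D}G^*$ and $K=\mathcal{D}G^*\otimes\mathcal{D}G^*$. The space $F$ carries a Frobenius algebra structure with unit, product, counit and coproduct $$\eta_F=\sum_{x\in G}\beta_{e|x},\quad m_F(\beta_{g|x}\otimes\beta_{h|y})=\delta_{x,y}\,\beta_{hg|x},\quad \varepsilon_F(\beta_{g|x})=\delta_{g,e},\quad \Delta_F(\beta_{g|x})=\sum_{h\in G}\beta_{h^{-1}g|x}\otimes\beta_{h|x},$$ and $K$ acts on $F$ by the linear map $\rho^K_F:K\otimes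 F\to F$, $$\rho^K_F(\beta_{g|x}\otimes\beta_{h|y}\otimes\beta_{k|z})=\delta_{z,\,xzy}\;\delta_{k,x}\;\beta_{g^{-1}xg\,|\,g^{-1}zy^{-1}hy}.$$ Set $\mathrm{Cor}_{1;1,1}:=m_F\circ(\rho^K_F\otimes \mathrm{id}_F)\circ(\mathrm{id}_K\otimes\Delta_F):K\otimes F\to F$. The torus partition function is $\mathrm{Cor}_{1;0,0}:=\varepsilon_F\circ\mathrm{Cor}_{1;1,1}\circ(\mathrm{id}_K\otimes\eta_F):K\to\Bbbk$, with $\eta_F$ regarded as a map $\Bbbk\to F$. The S- and T-transformations of the modular group act on $\mathrm{Cor}_{1;0,0}$ by precomposition with the linear maps $S_K,T_K:K\to K$ given by $$S_K(\beta_{g|x}\otimes\beta_{h|y})=\beta_{g^{-1}xg\,|\,g^{-1}}\otimes\beta_{y^{-1}\,|\,y^{-1}hy},\qquad T_K(\beta_{g|x}\otimes\beta_{h|y})=\beta_{g|gx}\otimes\beta_{h|h^{-1}y}.$$ *)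

theory Defs
  imports "HOL-Algebra.Group" "HOL-Computational_Algebra.Polynomial"
begin

section \<open>Vector spaces with a finite basis and their tensor products\<close>

text \<open>
  A vector space with a finite basis indexed by \<open>B\<close> is given by the coefficient
  families \<open>v :: 'i \<Rightarrow> 'k\<close> vanishing outside \<open>B\<close>.
  The tensor product of the spaces with basis indices \<open>B\<close> and \<open>C\<close> is then the space with
  basis indices \<open>B \<times> C\<close>, and \<open>vec_tensor\<close> is its universal bilinear map.
\<close>

definition vec_space :: "'i set \<Rightarrow> ('i \<Rightarrow> 'k::field) set" where
  "vec_space B = {v. \<forall>i. i \<notin> B \<longrightarrow> v i = 0}"

definition basis_vec :: "'i \<Rightarrow> 'i \<Rightarrow> 'k::field" where
  "basis_vec i = (\<lambda>j. of_bool (i = j))"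

definition vec_scale :: "'k::field \<Rightarrow> ('i \<Rightarrow> 'k) \<Rightarrow> 'i \<Rightarrow> 'k" where
  "vec_scale c v = (\<lambda>i. c * v i)"

definition vec_tensor :: "('i \<Rightarrow> 'k::field) \<Rightarrow> ('j \<Rightarrow> 'k) \<Rightarrow> 'i \<times> 'j \<Rightarrow> 'k" where
  "vec_tensor v w = (\<lambda>(i, j). v i * w j)"

text \<open>
  The linear form, respectively linear map, on the space with basis indices \<open>B\<close> that takes
  the value \<open>f i\<close> on the \<open>i\<close>-th basis vector.
\<close>

definition lin_form :: "'i set \<Rightarrow> ('i \<Rightarrow> 'k::field) \<Rightarrow> ('i \<Rightarrow> 'k) \<Rightarrow> 'k" where
  "lin_form B f v = (\<Sum>i\<in>B. v i * f i)"

definition lin_map :: "'i set \<Rightarrow> ('i \<Rightarrow> 'j \<Rightarrow> 'k::field) \<Rightarrow> ('i \<Rightarrow> 'k) \<Rightarrow> 'j \<Rightarrow> 'k" where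
  "lin_map B f v = (\<lambda>j. \<Sum>i\<in>B. v i * f i j)"

text \<open>
  Tensor product of two linear maps whose domains have basis indices \<open>B\<close> and \<open>C\<close>, and the
  associator \<open>U \<otimes> (V \<otimes> W) \<rightarrow> (U \<otimes> V) \<otimes> W\<close>.
\<close>

definition map_tensor ::
  "'i set \<Rightarrow> 'j set \<Rightarrow> (('i \<Rightarrow> 'k::field) \<Rightarrow> 'm \<Rightarrow> 'k) \<Rightarrow> (('j \<Rightarrow> 'k) \<Rightarrow> 'n \<Rightarrow> 'k)
    \<Rightarrow> ('i \<times> 'j \<Rightarrow> 'k) \<Rightarrow> 'm \<times> 'n \<Rightarrow> 'k" where
  "map_tensor B C f g =
     lin_map (B \<times> C) (\<lambda>(i, j). vec_tensor (f (basis_vec i)) (g (basis_vec j)))"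

definition tensor_assoc :: "('i \<times> 'j \<times> 'l \<Rightarrow> 'k::field) \<Rightarrow> ('i \<times> 'j) \<times> 'l \<Rightarrow> 'k" where
  "tensor_assoc t = (\<lambda>((i, j), l). t (i, (j, l)))"

lemma vec_tensor_basis:
  "vec_tensor (basis_vec i) (basis_vec j) = (basis_vec (i, j) :: _ \<Rightarrow> 'k::field)"
  by (auto simp: vec_tensor_def basis_vec_def fun_eq_iff)

lemma lin_form_basis: "finite B \<Longrightarrow> i \<in> B \<Longrightarrow> lin_form B f (basis_vec i) = f i"
  by (simp add: lin_form_def basis_vec_def)

lemma lin_map_basis: "finite B \<Longrightarrow> i \<in> B \<Longrightarrow> lin_map B f (basis_vec i) = f i"
  by (simp add: lin_map_def basis_vec_def fun_eq_iff)

lemma map_tensor_vec_tensor: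
  assumes "finite B" "finite C"
  shows "map_tensor B C (lin_map B f) (lin_map C g) (vec_tensor v w)
           = vec_tensor (lin_map B f v) (lin_map C g w)"
proof -
  have "map_tensor B C (lin_map B f) (lin_map C g) (vec_tensor v w) (m, n)
          = (\<Sum>i\<in>B. \<Sum>j\<in>C. (v i * f i m) * (w j * g j n))" for m n
    unfolding map_tensor_def lin_map_def[of "B \<times> C"] sum.cartesian_product
    using assms by (intro sum.cong) (auto simp: lin_map_basis vec_tensor_def)
  thus ?thesis
    by (auto simp: fun_eq_iff vec_tensor_def lin_map_def sum_product)
qed


section \<open>The torus partition function of the Drinfeld double\<close>

context
  fixes G :: "('a, 'b) monoid_scheme" (structure)
begin

text \<open>
  The double has basis \<open>b g x\<close>, and a linear form on it is recorded by its values on this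
  basis: \<open>\<phi>\<close> corresponds to \<open>(g, x) \<mapsto> \<phi> (b g x)\<close>.  The dual basis vector
  \<open>\<beta> g x\<close> is thereby the basis vector with index \<open>(g, x)\<close>.
\<close>

definition F_idx :: "('a \<times> 'a) set" where
  "F_idx = carrier G \<times> carrier G"

definition K_idx :: "(('a \<times> 'a) \<times> ('a \<times> 'a)) set" where
  "K_idx = F_idx \<times> F_idx"

definition K_space :: "(('a \<times> 'a) \<times> ('a \<times> 'a) \<Rightarrow> 'k::field) set" where
  "K_space = vec_space K_idx"

abbreviation beta :: "'a \<Rightarrow> 'a \<Rightarrow> 'a \<times> 'a \<Rightarrow> 'k::field" where
  "beta g x \<equiv> basis_vec (g, x)"

definition eta_F :: "'a \<times> 'a \<Rightarrow> 'k::field" where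
  "eta_F = (\<lambda>i. \<Sum>x\<in>carrier G. beta \<one> x i)"

definition m_F :: "(('a \<times> 'a) \<times> ('a \<times> 'a) \<Rightarrow> 'k::field) \<Rightarrow> 'a \<times> 'a \<Rightarrow> 'k" where
  "m_F = lin_map (F_idx \<times> F_idx)
     (\<lambda>((g, x), (h, y)). vec_scale (of_bool (x = y)) (beta (h \<otimes> g) x))"

definition eps_F :: "('a \<times> 'a \<Rightarrow> 'k::field) \<Rightarrow> 'k" where
  "eps_F = lin_form F_idx (\<lambda>(g, x). of_bool (g = \<one>))"

definition Delta_F :: "('a \<times> 'a \<Rightarrow> 'k::field) \<Rightarrow> ('a \<times> 'a) \<times> ('a \<times> 'a) \<Rightarrow> 'k" where
  "Delta_F = lin_map F_idx
     (\<lambda>(g, x) i. \<Sum>h\<in>carrier G. vec_tensor (beta (inv h \<otimes> g) x) (beta h x) i)"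

definition rho_KF ::
  "((('a \<times> 'a) \<times> ('a \<times> 'a)) \<times> ('a \<times> 'a) \<Rightarrow> 'k::field) \<Rightarrow> 'a \<times> 'a \<Rightarrow> 'k" where
  "rho_KF = lin_map (K_idx \<times> F_idx)
     (\<lambda>(((g, x), (h, y)), (k, z)).
        vec_scale (of_bool (z = x \<otimes> z \<otimes> y) * of_bool (k = x))
          (beta (inv g \<otimes> x \<otimes> g) (inv g \<otimes> z \<otimes> inv y \<otimes> h \<otimes> y)))"

definition Cor_1_1_1 ::
  "((('a \<times> 'a) \<times> ('a \<times> 'a)) \<times> ('a \<times> 'a) \<Rightarrow> 'k::field) \<Rightarrow> 'a \<times> 'a \<Rightarrow> 'k" where
  "Cor_1_1_1 =
     m_F \<circ> map_tensor (K_idx \<times> F_idx) F_idx rho_KF id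
         \<circ> tensor_assoc
         \<circ> map_tensor K_idx F_idx id Delta_F"

text \<open>
  Under \<open>K \<cong> K \<otimes> k\<close> the map \<open>id \<otimes> \<eta>\<close> is \<open>w \<mapsto> w \<otimes> \<eta>(1)\<close>.
\<close>

definition Cor_1_0_0 :: "(('a \<times> 'a) \<times> ('a \<times> 'a) \<Rightarrow> 'k::field) \<Rightarrow> 'k" where
  "Cor_1_0_0 = eps_F \<circ> Cor_1_1_1 \<circ> (\<lambda>w. vec_tensor w eta_F)"

definition S_K ::
  "(('a \<times> 'a) \<times> ('a \<times> 'a) \<Rightarrow> 'k::field) \<Rightarrow> ('a \<times> 'a) \<times> ('a \<times> 'a) \<Rightarrow> 'k" where
  "S_K = lin_map K_idx
     (\<lambda>((g, x), (h, y)).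
        vec_tensor (beta (inv g \<otimes> x \<otimes> g) (inv g)) (beta (inv y) (inv y \<otimes> h \<otimes> y)))"

definition T_K ::
  "(('a \<times> 'a) \<times> ('a \<times> 'a) \<Rightarrow> 'k::field) \<Rightarrow> ('a \<times> 'a) \<times> ('a \<times> 'a) \<Rightarrow> 'k" where
  "T_K = lin_map K_idx
     (\<lambda>((g, x), (h, y)).
        vec_tensor (beta g (g \<otimes> x)) (beta h (inv h \<otimes> y)))"

end

end

(*
  On a basis vector, Cor_{1;0,0}(beta_{g|x} (x) beta_{h|y}) is the number of z in G with
  h = z^{-1} g z and y = z^{-1} x^{-1} z if g and x commute, and 0 otherwise.
  Both S_K and T_K map basis vectors to basis vectors, and for every single z the condition
  on z, together with g x = x g, is stable under these maps.  In particular no integer ever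
  has to be inverted in the field.
*)
theory Submission
  imports Defs "HOL-Library.Function_Algebras"
begin

section \<open>Linear maps on coefficient families and their values on basis vectors\<close>

lemma sum_fun_apply: "(\<Sum>i\<in>A. f i) j = (\<Sum>i\<in>A. f i j :: 'k::comm_monoid_add)"
  by (induction A rule: infinite_finite_induct) auto

text \<open>The vector space is the full function type with pointwise addition, not
  \<open>vec_space B\<close>. The maps involved are defined on the whole type, so their linearity
  can be stated without carriers; \<open>vec_space\<close> enters only when a vector is expanded in
  a basis.\<close>

interpretation vec: vector_space "vec_scale :: 'k::field \<Rightarrow> ('i \<Rightarrow> 'k) \<Rightarrow> 'i \<Rightarrow> 'k"
  by unfold_locales (auto simp: vec_scale_def fun_eq_iff algebra_simps)

lemma vector_space_field: "vector_space ((*) :: 'k::field \<Rightarrow> 'k \<Rightarrow> 'k)"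
  by unfold_locales (auto simp: algebra_simps)

lemmas linear_sum = module_hom.sum[OF module_hom_linearI]
lemmas linear_scale = module_hom.scale[OF module_hom_linearI]

lemma linear_vecI:
  fixes L :: "('i \<Rightarrow> 'k::field) \<Rightarrow> 'j \<Rightarrow> 'k"
  assumes "\<And>v w j. L (v + w) j = L v j + L w j" and "\<And>c v j. L (vec_scale c v) j = c * L v j"
  shows "Vector_Spaces.linear vec_scale vec_scale L"
  unfolding Vector_Spaces.linear_iff
proof (intro conjI allI vec.vector_space_axioms ext)
  show "L (v + w) j = (L v + L w) j" for v w j
    by (simp only: assms(1) plus_fun_apply)
  show "L (vec_scale c v) j = vec_scale c (L v) j" for c v j
    using assms(2)[of c v j] by (simp only: vec_scale_def)
qed

lemma linear_lin_map:
  "Vector_Spaces.linear vec_scale vec_scale (lin_map B (f :: 'i \<Rightarrow> 'j \<Rightarrow> 'k::field))"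
  by (rule linear_vecI)
     (simp_all add: lin_map_def vec_scale_def distrib_right sum.distrib sum_distrib_left mult.assoc)

lemma linear_lin_form:
  "Vector_Spaces.linear vec_scale (*) (lin_form B (f :: 'i \<Rightarrow> 'k::field))"
  unfolding Vector_Spaces.linear_iff
  by (intro conjI allI vec.vector_space_axioms vector_space_field)
     (simp_all add: lin_form_def vec_scale_def distrib_right sum.distrib sum_distrib_left mult.assoc)

lemma linear_tensor_assoc:
  "Vector_Spaces.linear vec_scale vec_scale
     (tensor_assoc :: ('i \<times> 'j \<times> 'l \<Rightarrow> 'k::field) \<Rightarrow> _)"
  by (rule linear_vecI) (simp_all add: tensor_assoc_def vec_scale_def split_beta)

lemma linear_vec_tensor_left:
  "Vector_Spaces.linear vec_scale vec_scale (\<lambda>v. vec_tensor v (u :: 'j \<Rightarrow> 'k::field))"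
  by (rule linear_vecI) (simp_all add: vec_tensor_def vec_scale_def split_beta distrib_right)

lemma linear_vec_tensor_right:
  "Vector_Spaces.linear vec_scale vec_scale (vec_tensor (v :: 'i \<Rightarrow> 'k::field))"
  by (rule linear_vecI) (simp_all add: vec_tensor_def vec_scale_def split_beta distrib_left)

text \<open>A tensor product of maps is by construction a \<open>lin_map\<close>, built from the
  values of \<open>f\<close> and \<open>g\<close> on basis vectors, so it is linear for arbitrary
  \<open>f\<close> and \<open>g\<close>.\<close>

lemma linear_map_tensor:
  "Vector_Spaces.linear vec_scale vec_scale
     (map_tensor B C f (g :: ('j \<Rightarrow> 'k::field) \<Rightarrow> 'n \<Rightarrow> 'k))"
  unfolding map_tensor_def by (rule linear_lin_map)

lemma map_tensor_basis:
  assumes "finite B" "finite C" "i \<in> B" "j \<in> C"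
  shows "map_tensor B C f g (basis_vec (i, j)) = vec_tensor (f (basis_vec i)) (g (basis_vec j))"
  using assms by (simp add: map_tensor_def lin_map_basis)

lemma tensor_assoc_basis:
  "tensor_assoc (basis_vec (i, j, l)) = basis_vec ((i, j), l)"
  by (auto simp: tensor_assoc_def basis_vec_def fun_eq_iff)

lemma vec_space_expansion:
  fixes w :: "'i \<Rightarrow> 'k::field"
  assumes "finite B" "w \<in> vec_space B"
  shows "w = (\<Sum>i\<in>B. vec_scale (w i) (basis_vec i))"
proof
  fix j
  have "(\<Sum>i\<in>B. w i * of_bool (i = j)) = (\<Sum>i\<in>B. if i = j then w i else 0)"
    by (intro sum.cong) auto
  also have "\<dots> = w j"
    using assms by (auto simp: vec_space_def)
  finally show "w j = (\<Sum>i\<in>B. vec_scale (w i) (basis_vec i)) j"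
    by (simp add: sum_fun_apply vec_scale_def basis_vec_def)
qed

text \<open>Expand \<open>w\<close> in the finite basis and use linearity. The conclusion is limited
  to \<open>vec_space B\<close> because the two forms may differ on families with support outside
  \<open>B\<close>.\<close>

lemma linear_form_eq_on_basis:
  fixes w :: "'i \<Rightarrow> 'k::field"
  assumes f: "Vector_Spaces.linear vec_scale (*) f" and g: "Vector_Spaces.linear vec_scale (*) g"
    and "finite B" "w \<in> vec_space B"
    and eq: "\<And>i. i \<in> B \<Longrightarrow> f (basis_vec i) = g (basis_vec i)"
  shows "f w = g w"
proof -
  note [simp] = linear_sum[OF f] linear_scale[OF f]
    linear_sum[OF g] linear_scale[OF g]
  have "f (\<Sum>i\<in>B. vec_scale (w i) (basis_vec i)) = g (\<Sum>i\<in>B. vec_scale (w i) (basis_vec i))"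
    by (simp add: eq)
  thus ?thesis
    using vec_space_expansion[OF assms(3,4)] by simp
qed

lemma linear_Cor_1_1_1:
  "Vector_Spaces.linear vec_scale vec_scale (Cor_1_1_1 G :: _ \<Rightarrow> _ \<Rightarrow> 'k::field)"
  unfolding Cor_1_1_1_def m_F_def
  by (intro Vector_Spaces.linear_compose[OF _ linear_lin_map]
        Vector_Spaces.linear_compose[OF linear_map_tensor]
        Vector_Spaces.linear_compose[OF linear_tensor_assoc] linear_map_tensor)

lemma linear_Cor_1_0_0:
  "Vector_Spaces.linear vec_scale (*) (Cor_1_0_0 G :: _ \<Rightarrow> 'k::field)"
  unfolding Cor_1_0_0_def eps_F_def
  by (intro Vector_Spaces.linear_compose[OF linear_vec_tensor_left]
        Vector_Spaces.linear_compose[OF linear_Cor_1_1_1 linear_lin_form])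

section \<open>Values of the correlators on basis vectors, and the group conditions behind
  them\<close>

context group
begin

text \<open>The \<open>F\<close>-component has first index \<open>\<one>\<close> because only such
  vectors occur in \<open>eta_F\<close>. The index \<open>l\<close> runs over the coproduct; the
  first two Kronecker deltas come from the action \<open>rho_KF\<close>, the third from the product,
  which requires equal second labels.\<close>

lemma Cor_1_1_1_basis:
  assumes fin: "finite (carrier G)"
    and G: "g \<in> carrier G" "x \<in> carrier G" "h \<in> carrier G" "y \<in> carrier G" "z \<in> carrier G"
  shows "Cor_1_1_1 G (basis_vec (((g, x), (h, y)), (\<one>, z))) =
    (\<Sum>l\<in>carrier G. vec_scale (of_bool (z = x \<otimes> z \<otimes> y) * of_bool (inv l = x)
        * of_bool (inv g \<otimes> z \<otimes> inv y \<otimes> h \<otimes> y = z))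
      (beta (l \<otimes> (inv g \<otimes> x \<otimes> g)) (inv g \<otimes> z \<otimes> inv y \<otimes> h \<otimes> y)) :: _ \<Rightarrow> 'k::field)"
proof -
  let ?k = "((g, x), (h, y))"
  let ?u = "inv g \<otimes> z \<otimes> inv y \<otimes> h \<otimes> y"
  let ?c = "\<lambda>l. of_bool (z = x \<otimes> z \<otimes> y) * of_bool (inv l = x) :: 'k"
  note finite = fin finite_cartesian_product F_idx_def K_idx_def
  have Delta: "Delta_F G (beta \<one> z) = (\<Sum>l\<in>carrier G. basis_vec ((inv l, z), (l, z)) :: _ \<Rightarrow> 'k)"
    using G fin
    by (simp add: Delta_F_def lin_map_basis F_idx_def vec_tensor_basis fun_eq_iff sum_fun_apply)
  have rho: "rho_KF G (basis_vec (?k, (inv l, z)))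
      = vec_scale (?c l) (beta (inv g \<otimes> x \<otimes> g) ?u)" if "l \<in> carrier G" for l
    using G fin that by (simp add: rho_KF_def lin_map_basis F_idx_def K_idx_def)
  have m: "m_F G (basis_vec ((inv g \<otimes> x \<otimes> g, ?u), (l, z)))
      = vec_scale (of_bool (?u = z)) (beta (l \<otimes> (inv g \<otimes> x \<otimes> g)) ?u :: _ \<Rightarrow> 'k)"
    if "l \<in> carrier G" for l
    using G fin that by (simp add: m_F_def lin_map_basis F_idx_def K_idx_def)
  have "map_tensor (K_idx G) (F_idx G) id (Delta_F G) (basis_vec (?k, (\<one>, z)))
      = (\<Sum>l\<in>carrier G. basis_vec (?k, ((inv l, z), (l, z))) :: _ \<Rightarrow> 'k)"
    using G fin
    by (simp add: map_tensor_basis finite Delta vec_tensor_basis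
        linear_sum[OF linear_vec_tensor_right])
  \<comment> \<open>The associator groups \<open>K\<close> with the first leg of the coproduct, so
    that \<open>rho_KF\<close> acts there while \<open>id\<close> keeps the second leg.\<close>
  hence "Cor_1_1_1 G (basis_vec (?k, (\<one>, z))) = m_F G (\<Sum>l\<in>carrier G.
      map_tensor (K_idx G \<times> F_idx G) (F_idx G) (rho_KF G) id
        (basis_vec ((?k, (inv l, z)), (l, z)) :: _ \<Rightarrow> 'k))"
    by (simp add: Cor_1_1_1_def tensor_assoc_basis
        linear_sum[OF linear_tensor_assoc]
        linear_sum[OF linear_map_tensor])
  also have "\<dots> = m_F G (\<Sum>l\<in>carrier G.
      vec_scale (?c l) (basis_vec ((inv g \<otimes> x \<otimes> g, ?u), (l, z))))"
    using G fin
    by (intro arg_cong[of _ _ "m_F G"] sum.cong refl)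
       (simp add: map_tensor_basis finite rho vec_tensor_basis
          linear_scale[OF linear_vec_tensor_left])
  also have "\<dots> = (\<Sum>l\<in>carrier G.
      vec_scale (?c l) (m_F G (basis_vec ((inv g \<otimes> x \<otimes> g, ?u), (l, z)))))"
    unfolding m_F_def
    by (simp only: linear_sum[OF linear_lin_map]
        linear_scale[OF linear_lin_map])
  also have "\<dots> = (\<Sum>l\<in>carrier G. vec_scale (?c l * of_bool (?u = z))
      (beta (l \<otimes> (inv g \<otimes> x \<otimes> g)) ?u))"
    by (intro sum.cong refl) (simp only: m vec.scale_scale)
  finally show ?thesis .
qed

text \<open>Complements \<open>m_assoc\<close> as a rewrite rule: once products are nested to the
  right, an adjacent pair of inverse factors stands in front of a remaining product, and these
  equations cancel it.\<close>

lemma inv_mult_cancel_left: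
  assumes "x \<in> carrier G" "y \<in> carrier G"
  shows "inv x \<otimes> (x \<otimes> y) = y" and "x \<otimes> (inv x \<otimes> y) = y"
  using assms by (simp_all flip: m_assoc)

lemma conj_eq_iff:
  assumes "x \<in> carrier G" "y \<in> carrier G" "a \<in> carrier G"
  shows "inv y \<otimes> x \<otimes> y = a \<longleftrightarrow> x = y \<otimes> a \<otimes> inv y"
  using assms by (auto simp: m_assoc inv_mult_cancel_left)

lemma conj_eq_self_iff:
  assumes "x \<in> carrier G" "y \<in> carrier G"
  shows "inv y \<otimes> x \<otimes> y = x \<longleftrightarrow> y \<otimes> x = x \<otimes> y"
  using assms by (auto simp: m_assoc inv_solve_left')

text \<open>Conjugating by \<open>z\<close> carries \<open>x\<close> to \<open>inv y\<close> and
  \<open>g\<close> to \<open>inv z \<otimes> g \<otimes> z\<close>. Since \<open>x\<close> and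
  \<open>g\<close> commute, so do these images, and conjugation by \<open>y\<close> fixes the second
  one.\<close>

lemma conj_by_torus_condition:
  assumes G: "g \<in> carrier G" "x \<in> carrier G" "h \<in> carrier G" "y \<in> carrier G" "z \<in> carrier G"
    and comm: "g \<otimes> x = x \<otimes> g" and y: "y = inv z \<otimes> inv x \<otimes> z"
  shows "inv y \<otimes> h \<otimes> y = inv z \<otimes> g \<otimes> z \<longleftrightarrow> h = inv z \<otimes> g \<otimes> z"
proof -
  have gx: "inv x \<otimes> g \<otimes> x = g"
    using G comm by (simp add: conj_eq_self_iff)
  have "inv y \<otimes> h \<otimes> y = inv z \<otimes> g \<otimes> z \<longleftrightarrow> h = y \<otimes> (inv z \<otimes> g \<otimes> z) \<otimes> inv y"
    using G by (simp only: conj_eq_iff m_closed inv_closed)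
  also have "y \<otimes> (inv z \<otimes> g \<otimes> z) \<otimes> inv y = inv z \<otimes> (inv x \<otimes> g \<otimes> x) \<otimes> z"
    using G by (simp add: y inv_mult_group m_assoc inv_mult_cancel_left)
  finally show ?thesis
    by (simp only: gx)
qed

text \<open>The conditions on the left come from the action, the product and the counit, with the
  coproduct index set to \<open>inv x\<close>. The counit condition says that \<open>g\<close> and
  \<open>x\<close> commute, the action determines \<open>y\<close>, and the product determines
  \<open>h\<close> up to a conjugation by \<open>y\<close> that is then harmless.\<close>

lemma torus_condition_iff:
  assumes G: "g \<in> carrier G" "x \<in> carrier G" "h \<in> carrier G" "y \<in> carrier G" "z \<in> carrier G"
  shows "z = x \<otimes> z \<otimes> y \<and> inv g \<otimes> z \<otimes> inv y \<otimes> h \<otimes> y = z \<and> inv x \<otimes> (inv g \<otimes> x \<otimes> g) = \<one>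
    \<longleftrightarrow> g \<otimes> x = x \<otimes> g \<and> h = inv z \<otimes> g \<otimes> z \<and> y = inv z \<otimes> inv x \<otimes> z"
proof -
  have "inv x \<otimes> (inv g \<otimes> x \<otimes> g) = \<one> \<longleftrightarrow> inv g \<otimes> x \<otimes> g = x"
    using G by (simp add: inv_solve_left')
  also have "\<dots> \<longleftrightarrow> g \<otimes> x = x \<otimes> g"
    using G by (simp add: conj_eq_self_iff)
  finally have "inv x \<otimes> (inv g \<otimes> x \<otimes> g) = \<one> \<longleftrightarrow> g \<otimes> x = x \<otimes> g" .
  moreover have "z = x \<otimes> z \<otimes> y \<longleftrightarrow> y = inv z \<otimes> inv x \<otimes> z"
    using G by (simp add: m_assoc inv_solve_left inv_solve_left')
  moreover have "inv g \<otimes> z \<otimes> inv y \<otimes> h \<otimes> y = z \<longleftrightarrow> inv y \<otimes> h \<otimes> y = inv z \<otimes> g \<otimes> z"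
    using G by (auto simp: m_assoc inv_solve_left inv_solve_left')
  ultimately show ?thesis
    using conj_by_torus_condition[OF G] by blast
qed

text \<open>The sum over \<open>z\<close> comes from the unit \<open>eta_F\<close>. It is left
  unevaluated, since the invariance can be checked for each \<open>z\<close> separately.\<close>

lemma Cor_1_0_0_basis:
  assumes fin: "finite (carrier G)"
    and G: "g \<in> carrier G" "x \<in> carrier G" "h \<in> carrier G" "y \<in> carrier G"
  shows "Cor_1_0_0 G (basis_vec ((g, x), (h, y))) = (\<Sum>z\<in>carrier G.
    of_bool (g \<otimes> x = x \<otimes> g \<and> h = inv z \<otimes> g \<otimes> z \<and> y = inv z \<otimes> inv x \<otimes> z) :: 'k::field)"
proof -
  let ?k = "((g, x), (h, y))"
  have eps: "Vector_Spaces.linear vec_scale (*) (eps_F G :: _ \<Rightarrow> 'k)"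
    unfolding eps_F_def by (rule linear_lin_form)
  have eta: "eta_F G = (\<Sum>z\<in>carrier G. beta \<one> z :: _ \<Rightarrow> 'k)"
    by (simp add: eta_F_def fun_eq_iff sum_fun_apply)
  have "Cor_1_0_0 G (basis_vec ?k) =
      (\<Sum>z\<in>carrier G. eps_F G (Cor_1_1_1 G (basis_vec (?k, (\<one>, z)) :: _ \<Rightarrow> 'k)))"
    by (simp add: Cor_1_0_0_def eta linear_sum[OF linear_vec_tensor_right]
        linear_sum[OF linear_Cor_1_1_1] linear_sum[OF eps] vec_tensor_basis)
  also have "\<dots> = (\<Sum>z\<in>carrier G.
    of_bool (g \<otimes> x = x \<otimes> g \<and> h = inv z \<otimes> g \<otimes> z \<and> y = inv z \<otimes> inv x \<otimes> z))"
  proof (intro sum.cong refl)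
    fix z assume z: "z \<in> carrier G"
    let ?u = "inv g \<otimes> z \<otimes> inv y \<otimes> h \<otimes> y"
    let ?P = "z = x \<otimes> z \<otimes> y" and ?Q = "?u = z"
    have "eps_F G (Cor_1_1_1 G (basis_vec (?k, (\<one>, z)) :: _ \<Rightarrow> 'k)) =
      (\<Sum>l\<in>carrier G. of_bool ?P * of_bool (inv l = x) * of_bool ?Q
        * of_bool (l \<otimes> (inv g \<otimes> x \<otimes> g) = \<one>))"
      using fin G z
      by (simp only: Cor_1_1_1_basis linear_sum[OF eps] linear_scale[OF eps], intro sum.cong refl)
         (simp add: eps_F_def lin_form_basis F_idx_def)
    \<comment> \<open>The action forces \<open>inv l = x\<close>, so a single term of the coproduct
      survives.\<close>
    also have "\<dots> = (\<Sum>l\<in>carrier G. if l = inv x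
        then of_bool (?P \<and> ?Q \<and> inv x \<otimes> (inv g \<otimes> x \<otimes> g) = \<one>) else 0)"
      using G by (intro sum.cong refl) auto
    also have "\<dots> = of_bool (?P \<and> ?Q \<and> inv x \<otimes> (inv g \<otimes> x \<otimes> g) = \<one>)"
      using fin G by simp
    finally show "eps_F G (Cor_1_1_1 G (basis_vec (?k, (\<one>, z)) :: _ \<Rightarrow> 'k)) =
      of_bool (g \<otimes> x = x \<otimes> g \<and> h = inv z \<otimes> g \<otimes> z \<and> y = inv z \<otimes> inv x \<otimes> z)"
      using torus_condition_iff[OF G z] by simp
  qed
  finally show ?thesis .
qed

text \<open>The left side is the condition of \<open>Cor_1_0_0_basis\<close> at the indices produced
  by \<open>S_K\<close>. Its first part amounts to \<open>inv g \<otimes> x \<otimes> g = x\<close>;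
  given this, the other two parts swap roles: the equation for \<open>inv y\<close> is the inverse
  of the one for \<open>y\<close>, and the last one fixes \<open>h\<close> up to conjugation by
  \<open>y\<close>.\<close>

lemma torus_condition_S:
  assumes G: "g \<in> carrier G" "x \<in> carrier G" "h \<in> carrier G" "y \<in> carrier G" "z \<in> carrier G"
  shows "(inv g \<otimes> x \<otimes> g) \<otimes> inv g = inv g \<otimes> (inv g \<otimes> x \<otimes> g)
      \<and> inv y = inv z \<otimes> (inv g \<otimes> x \<otimes> g) \<otimes> z \<and> inv y \<otimes> h \<otimes> y = inv z \<otimes> inv (inv g) \<otimes> z
    \<longleftrightarrow> g \<otimes> x = x \<otimes> g \<and> h = inv z \<otimes> g \<otimes> z \<and> y = inv z \<otimes> inv x \<otimes> z"
proof -
  have "(inv g \<otimes> x \<otimes> g) \<otimes> inv g = inv g \<otimes> (inv g \<otimes> x \<otimes> g) \<longleftrightarrow> x = inv g \<otimes> x \<otimes> g"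
    using G by (simp add: m_assoc)
  also have "\<dots> \<longleftrightarrow> g \<otimes> x = x \<otimes> g"
    using G conj_eq_self_iff[of x g] by auto
  finally have "(inv g \<otimes> x \<otimes> g) \<otimes> inv g = inv g \<otimes> (inv g \<otimes> x \<otimes> g) \<longleftrightarrow> g \<otimes> x = x \<otimes> g" .
  moreover have "inv y = inv z \<otimes> (inv g \<otimes> x \<otimes> g) \<otimes> z \<longleftrightarrow> y = inv z \<otimes> inv x \<otimes> z"
    if "g \<otimes> x = x \<otimes> g"
  proof -
    have "inv g \<otimes> x \<otimes> g = x"
      using G that by (simp add: conj_eq_self_iff)
    \<comment> \<open>After replacing the conjugate of \<open>x\<close> by \<open>x\<close>, the
      right side is the inverse of the expected value of \<open>y\<close>, and inversion is
      injective on the carrier.\<close>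
    hence "inv y = inv z \<otimes> (inv g \<otimes> x \<otimes> g) \<otimes> z \<longleftrightarrow> inv y = inv (inv z \<otimes> inv x \<otimes> z)"
      using G by (simp add: inv_mult_group m_assoc)
    also have "\<dots> \<longleftrightarrow> y = inv z \<otimes> inv x \<otimes> z"
      using G by (intro inj_on_eq_iff[OF inv_inj]) simp_all
    finally show ?thesis .
  qed
  \<comment> \<open>This brings the last condition into the shape of
    \<open>conj_by_torus_condition\<close>.\<close>
  moreover have "inv (inv g) = g"
    using G by simp
  ultimately show ?thesis
    using conj_by_torus_condition[OF G] by metis
qed

text \<open>The left side is the condition of \<open>Cor_1_0_0_basis\<close> at the indices produced
  by \<open>T_K\<close>. Commuting with \<open>g \<otimes> x\<close> is the same for
  \<open>g\<close> as commuting with \<open>x\<close>, and the extra factors \<open>inv h\<close>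
  and \<open>inv g\<close> in the last equation match under conjugation by \<open>z\<close>.\<close>

lemma torus_condition_T:
  assumes G: "g \<in> carrier G" "x \<in> carrier G" "h \<in> carrier G" "y \<in> carrier G" "z \<in> carrier G"
  shows "g \<otimes> (g \<otimes> x) = (g \<otimes> x) \<otimes> g
      \<and> h = inv z \<otimes> g \<otimes> z \<and> inv h \<otimes> y = inv z \<otimes> inv (g \<otimes> x) \<otimes> z
    \<longleftrightarrow> g \<otimes> x = x \<otimes> g \<and> h = inv z \<otimes> g \<otimes> z \<and> y = inv z \<otimes> inv x \<otimes> z"
    (is "?c \<and> ?h \<and> ?y \<longleftrightarrow> ?c' \<and> ?h \<and> ?y'")
proof -
  have c: "?c \<longleftrightarrow> ?c'"
    using G by (simp add: m_assoc)
  have y: "?y \<longleftrightarrow> ?y'" if ?c' ?h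
  proof -
    have "?y \<longleftrightarrow> y = h \<otimes> (inv z \<otimes> inv (g \<otimes> x) \<otimes> z)"
      using G by (simp add: inv_solve_left')
    \<comment> \<open>Commutation turns \<open>g \<otimes> x\<close> into
      \<open>x \<otimes> g\<close>, whose inverse starts with \<open>inv g\<close> and so cancels
      the \<open>g\<close> contributed by \<open>h\<close>.\<close>
    also have "h \<otimes> (inv z \<otimes> inv (g \<otimes> x) \<otimes> z) = inv z \<otimes> (g \<otimes> inv (x \<otimes> g)) \<otimes> z"
      using G that by (simp add: m_assoc inv_mult_cancel_left)
    also have "g \<otimes> inv (x \<otimes> g) = inv x"
      using G by (simp add: inv_mult_group inv_mult_cancel_left)
    finally show ?thesis .
  qed
  show ?thesis
    using c y by blast
qed

section \<open>Modular invariance, from basis vectors to all of \<open>K\<close>\<close>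

lemma S_K_basis:
  assumes "finite (carrier G)" "g \<in> carrier G" "x \<in> carrier G" "h \<in> carrier G" "y \<in> carrier G"
  shows "S_K G (basis_vec ((g, x), (h, y))) =
    basis_vec ((inv g \<otimes> x \<otimes> g, inv g), (inv y, inv y \<otimes> h \<otimes> y))"
  using assms by (simp add: S_K_def lin_map_basis K_idx_def F_idx_def vec_tensor_basis)

lemma T_K_basis:
  assumes "finite (carrier G)" "g \<in> carrier G" "x \<in> carrier G" "h \<in> carrier G" "y \<in> carrier G"
  shows "T_K G (basis_vec ((g, x), (h, y))) = basis_vec ((g, g \<otimes> x), (h, inv h \<otimes> y))"
  using assms by (simp add: T_K_def lin_map_basis K_idx_def F_idx_def vec_tensor_basis)

text \<open>Both sides are linear forms in \<open>w\<close>, so the finite basis of \<open>K\<close>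
  decides. An arbitrary linear \<open>L\<close> serves \<open>S_K\<close> and \<open>T_K\<close>
  alike.\<close>

lemma Cor_1_0_0_invariantI:
  fixes w :: "('a \<times> 'a) \<times> ('a \<times> 'a) \<Rightarrow> 'k::field"
  assumes fin: "finite (carrier G)" and w: "w \<in> K_space G"
    and L: "Vector_Spaces.linear vec_scale vec_scale L"
    and basis: "\<And>g x h y. g \<in> carrier G \<Longrightarrow> x \<in> carrier G \<Longrightarrow> h \<in> carrier G \<Longrightarrow> y \<in> carrier G \<Longrightarrow>
      Cor_1_0_0 G (L (basis_vec ((g, x), (h, y)))) = Cor_1_0_0 G (basis_vec ((g, x), (h, y)))"
  shows "(Cor_1_0_0 G \<circ> L) w = Cor_1_0_0 G w"
proof (rule linear_form_eq_on_basis[where f = "Cor_1_0_0 G \<circ> L" and g = "Cor_1_0_0 G"])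
  show "Vector_Spaces.linear vec_scale (*) (Cor_1_0_0 G \<circ> L)"
    by (rule Vector_Spaces.linear_compose[OF L linear_Cor_1_0_0])
  show "finite (K_idx G)" "w \<in> vec_space (K_idx G)"
    using fin w by (simp_all add: K_idx_def F_idx_def K_space_def)
qed (auto simp: K_idx_def F_idx_def basis intro: linear_Cor_1_0_0)

lemma Cor_1_0_0_S_K:
  fixes w :: "('a \<times> 'a) \<times> ('a \<times> 'a) \<Rightarrow> 'k::field"
  assumes fin: "finite (carrier G)" and w: "w \<in> K_space G"
  shows "(Cor_1_0_0 G \<circ> S_K G) w = Cor_1_0_0 G w"
proof (rule Cor_1_0_0_invariantI[OF fin w])
  show "Vector_Spaces.linear vec_scale vec_scale (S_K G :: _ \<Rightarrow> _ \<Rightarrow> 'k)"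
    unfolding S_K_def by (rule linear_lin_map)
  fix g x h y assume G: "g \<in> carrier G" "x \<in> carrier G" "h \<in> carrier G" "y \<in> carrier G"
  show "Cor_1_0_0 G (S_K G (basis_vec ((g, x), (h, y)))) =
      (Cor_1_0_0 G (basis_vec ((g, x), (h, y))) :: 'k)"
    \<comment> \<open>The sums on both sides agree term by term; \<open>sum.cong\<close> supplies
      the membership of \<open>z\<close> in the carrier that \<open>torus_condition_S\<close>
      requires.\<close>
    using fin G
    by (simp only: S_K_basis Cor_1_0_0_basis m_closed inv_closed torus_condition_S cong: sum.cong)
qed

lemma Cor_1_0_0_T_K:
  fixes w :: "('a \<times> 'a) \<times> ('a \<times> 'a) \<Rightarrow> 'k::field"
  assumes fin: "finite (carrier G)" and w: "w \<in> K_space G"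
  shows "(Cor_1_0_0 G \<circ> T_K G) w = Cor_1_0_0 G w"
proof (rule Cor_1_0_0_invariantI[OF fin w])
  show "Vector_Spaces.linear vec_scale vec_scale (T_K G :: _ \<Rightarrow> _ \<Rightarrow> 'k)"
    unfolding T_K_def by (rule linear_lin_map)
  fix g x h y assume G: "g \<in> carrier G" "x \<in> carrier G" "h \<in> carrier G" "y \<in> carrier G"
  show "Cor_1_0_0 G (T_K G (basis_vec ((g, x), (h, y)))) =
      (Cor_1_0_0 G (basis_vec ((g, x), (h, y))) :: 'k)"
    using fin G
    by (simp only: T_K_basis Cor_1_0_0_basis m_closed inv_closed torus_condition_T cong: sum.cong)
qed

end

theorem mainTheorem2:
  fixes G :: "('a, 'b) monoid_scheme"
  assumes "group G" and "finite (carrier G)"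
  shows "(\<forall>w \<in> (K_space G :: (('a \<times> 'a) \<times> ('a \<times> 'a) \<Rightarrow> 'k::alg_closed_field) set).
            (Cor_1_0_0 G \<circ> S_K G) w = Cor_1_0_0 G w)
       \<and> (\<forall>w \<in> (K_space G :: (('a \<times> 'a) \<times> ('a \<times> 'a) \<Rightarrow> 'k) set).
            (Cor_1_0_0 G \<circ> T_K G) w = Cor_1_0_0 G w)"
  using group.Cor_1_0_0_S_K[OF assms] group.Cor_1_0_0_T_K[OF assms] by blast

end
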